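(* Let $\Omega\subset\mathbb{R}^d$ be a bounded domain with boundary $\Gamma$, let $L$ be a linear elliptic second-order differential operator with bounded coefficients on $\Omega$, and consider the Dirichlet problem $Lu=f$ in $\Omega$, $u=g$ on $\Gamma$. Let $U\subset C^2(\Omega)\cap C(\overline\Omega)$ be a Hilbert space of functions on $\overline\Omega$ with strictly positive definite reproducing kernel $K$ on which the functionals $\lambda_x(u)=Lu(x)$ $(x\in\Omega)$ and $\mu_y(u)=u(y)$ $(y\in\Gamma)$ are uniformly bounded (for instance $U=H^m(\Omega)$ with $m>2+d/2$), and assume well-posedness in the sup norm with a constant $C$: $$\|u\|_{\infty,\overline\Omega}\le C\max\big(\|Lu\|_{\infty,\Omega},\|u\|_{\infty,\Gamma}\big)\quad\text{for all }u\in U .$$ Then for every trial space $U_M=\mathrm{span}\{K(\cdot,x_1),\ldots,K(\cdot,x_M)\}$ with distinct nodes $x_1,\ldots,x_M\in\Omega$ there is a finite selection of test functionals $\nu_1,\ldots,\nu_N\in\Lambda:=\{\lambda_x:x\in\Omega\}\cup\{\mu_y:y\in\Gamma\}$ such that the following hold. (i) The stiffness matrix $A$ with entries $A_{kj}=\nu_k(s_j)$, written in terms of the nodal (Lagrange) basis $s_1,\ldots,s_M$ of $U_M$ (i.e. $s_j(x_k)=\delta_{jk}$), satisfies $$\|a\|_\infty\le 2C\,\|Aa\|_\infty\quad\text{for all }a\in\mathbb{R}^M .$$ (ii) If $C_A\ge1$, $u^*\in U$, $u_M^*\in U_M$, and $\tilde u_M\in U_M$ satisfy $$\max_{1\le k\le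 N}|\nu_k(u^*-\tilde u_M)|\le C_A\max_{1\le k\le N}|\nu_k(u^*-u_M^* )|,$$ then $$\|u^*-\tilde u_M\|_{\infty,\overline\Omega}\le C(2C_A+3)\max\big(\|L(u^*-u_M^* )\|_{\infty,\Omega},\|u^*-u_M^*\|_{\infty,\Gamma}\big).$$ In particular, for fixed $u^*$ and $C_A$ and a sequence of such trial spaces $U_M$ with such selections of test functionals, taking $u_M^*$ to be the interpolant of $u^*$ from $U_M$ at the nodes, if all derivatives of $u^*-u_M^*$ up to order two are $\mathcal{O}(\varepsilon_M)$ in the sup norm on $\Omega$, then $\|u^*-\tilde u_M\|_{\infty,\overline\Omega}=\mathcal{O}(\varepsilon_M)$.
   Context: The method described is unsymmetric (Kansa) collocation: the trial space is spanned by the kernel translates $K(\cdot,x_j)$ and the discretized problem consists of the (overdetermined) conditions $\nu_k(u_M)\approx\nu_k(u^* )$, $1\le k\le N$, solved by approximate residual minimization. Strict positive definiteness of $K$ means that all kernel matrices $(K(x_i,x_j))_{i,j}$ for distinct points are positive definite; it guarantees that the Lagrange basis of $U_M$ exists. $\|\cdot\|_{\infty,S}$ denotes the supremum norm over the set $S$. *)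

theory Defs
  imports "HOL-Analysis.Analysis"
begin

definition domain :: "(real ^ 'n) set \<Rightarrow> bool" where
  "domain \<Omega> \<longleftrightarrow> open \<Omega> \<and> connected \<Omega> \<and> \<Omega> \<noteq> {}"

text \<open>The supremum norm is extended-real valued, so that it is \<open>\<infinity>\<close> for unbounded functions.\<close>

definition sup_norm :: "'a set \<Rightarrow> ('a \<Rightarrow> real) \<Rightarrow> ereal" where
  "sup_norm S f = (SUP x\<in>S. ereal \<bar>f x\<bar>)"

text \<open>\<open>\<parallel>f\<^sub>n\<parallel> = O(\<epsilon>\<^sub>n)\<close> in the sup norm on \<open>S\<close>; written out because the norm is extended-real valued.\<close>

definition sup_norm_bigo :: "'a set \<Rightarrow> (nat \<Rightarrow> 'a \<Rightarrow> real) \<Rightarrow> (nat \<Rightarrow> real) \<Rightarrow> bool" where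
  "sup_norm_bigo S f \<epsilon> \<longleftrightarrow>
     (\<exists>c. \<forall>\<^sub>F n in sequentially. sup_norm S (f n) \<le> ereal (c * \<bar>\<epsilon> n\<bar>))"

text \<open>The norm on \<open>\<real>\<^sup>n\<close>, vectors being indexed by \<open>{..<n}\<close>; used only for \<open>n \<ge> 1\<close>.\<close>

definition max_norm :: "nat \<Rightarrow> (nat \<Rightarrow> real) \<Rightarrow> real" where
  "max_norm n v = Max ((\<lambda>i. \<bar>v i\<bar>) ` {..<n})"

definition mat_vec :: "nat \<Rightarrow> (nat \<Rightarrow> nat \<Rightarrow> real) \<Rightarrow> (nat \<Rightarrow> real) \<Rightarrow> nat \<Rightarrow> real" where
  "mat_vec M A a = (\<lambda>k. \<Sum>j<M. A k j * a j)"

definition partial_deriv :: "'n \<Rightarrow> (real ^ 'n \<Rightarrow> real) \<Rightarrow> real ^ 'n \<Rightarrow> real" where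
  "partial_deriv i u x = deriv (\<lambda>t. u (x + t *\<^sub>R axis i 1)) 0"

definition has_partial_deriv_on :: "'n \<Rightarrow> (real ^ 'n \<Rightarrow> real) \<Rightarrow> (real ^ 'n) set \<Rightarrow> bool" where
  "has_partial_deriv_on i u \<Omega> \<longleftrightarrow>
     (\<forall>x\<in>\<Omega>. (\<lambda>t. u (x + t *\<^sub>R axis i 1)) field_differentiable at 0)"

definition C2_on :: "(real ^ 'n) set \<Rightarrow> (real ^ 'n \<Rightarrow> real) \<Rightarrow> bool" where
  "C2_on \<Omega> u \<longleftrightarrow>
     continuous_on \<Omega> u \<and>
     (\<forall>i. has_partial_deriv_on i u \<Omega> \<and> continuous_on \<Omega> (partial_deriv i u)) \<and>
     (\<forall>i j. has_partial_deriv_on i (partial_deriv j u) \<Omega> \<and>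
            continuous_on \<Omega> (partial_deriv i (partial_deriv j u)))"

text \<open>Ellipticity is non-vanishing of the principal symbol at every point of \<open>\<Omega>\<close>, so both
  \<open>\<Delta>\<close> and \<open>-\<Delta>\<close> are covered and no uniformity is required.\<close>

definition elliptic_operator ::
    "(real ^ 'n) set \<Rightarrow> ((real ^ 'n \<Rightarrow> real) \<Rightarrow> real ^ 'n \<Rightarrow> real) \<Rightarrow> bool" where
  "elliptic_operator \<Omega> L \<longleftrightarrow>
     (\<exists>(a :: 'n \<Rightarrow> 'n \<Rightarrow> real ^ 'n \<Rightarrow> real) (b :: 'n \<Rightarrow> real ^ 'n \<Rightarrow> real) (c :: real ^ 'n \<Rightarrow> real).
        (\<forall>i j. bounded (a i j ` \<Omega>)) \<and> (\<forall>i. bounded (b i ` \<Omega>)) \<and> bounded (c ` \<Omega>) \<and>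
        (\<forall>x\<in>\<Omega>. \<forall>\<xi> :: real ^ 'n. \<xi> \<noteq> 0 \<longrightarrow> (\<Sum>i\<in>UNIV. \<Sum>j\<in>UNIV. a i j x * \<xi> $ i * \<xi> $ j) \<noteq> 0) \<and>
        (\<forall>u. C2_on \<Omega> u \<longrightarrow> (\<forall>x\<in>\<Omega>.
           L u x = (\<Sum>i\<in>UNIV. \<Sum>j\<in>UNIV. a i j x * partial_deriv i (partial_deriv j u) x)
                 + (\<Sum>i\<in>UNIV. b i x * partial_deriv i u x) + c x * u x)))"

text \<open>A Hilbert space \<open>U\<close> of real functions on a set \<open>D\<close>, with inner product \<open>ip\<close>. Functions on \<open>D\<close>
  are represented by total functions that vanish outside \<open>D\<close>, so that equality in \<open>U\<close> is equality
  on \<open>D\<close>.\<close>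

definition hilbert_function_space ::
    "'a set \<Rightarrow> ('a \<Rightarrow> real) set \<Rightarrow> (('a \<Rightarrow> real) \<Rightarrow> ('a \<Rightarrow> real) \<Rightarrow> real) \<Rightarrow> bool" where
  "hilbert_function_space D U ip \<longleftrightarrow>
     (\<forall>u\<in>U. \<forall>x. x \<notin> D \<longrightarrow> u x = 0) \<and>
     (\<lambda>x. 0) \<in> U \<and>
     (\<forall>u\<in>U. \<forall>v\<in>U. (\<lambda>x. u x + v x) \<in> U) \<and>
     (\<forall>r. \<forall>u\<in>U. (\<lambda>x. r * u x) \<in> U) \<and>
     (\<forall>u\<in>U. \<forall>v\<in>U. ip u v = ip v u) \<and>
     (\<forall>u\<in>U. \<forall>v\<in>U. \<forall>w\<in>U. ip (\<lambda>x. u x + v x) w = ip u w + ip v w) \<and>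
     (\<forall>r. \<forall>u\<in>U. \<forall>v\<in>U. ip (\<lambda>x. r * u x) v = r * ip u v) \<and>
     (\<forall>u\<in>U. u \<noteq> (\<lambda>x. 0) \<longrightarrow> 0 < ip u u) \<and>
     (\<forall>f. (\<forall>n. f n \<in> U) \<and>
          (\<forall>e>0. \<exists>n0::nat. \<forall>m\<ge>n0. \<forall>n\<ge>n0. sqrt (ip (f m - f n) (f m - f n)) < e) \<longrightarrow>
          (\<exists>l\<in>U. (\<lambda>n. sqrt (ip (f n - l) (f n - l))) \<longlonglongrightarrow> 0))"

definition reproducing_kernel ::
    "'a set \<Rightarrow> ('a \<Rightarrow> real) set \<Rightarrow> (('a \<Rightarrow> real) \<Rightarrow> ('a \<Rightarrow> real) \<Rightarrow> real) \<Rightarrow> ('a \<Rightarrow> 'a \<Rightarrow> real) \<Rightarrow> bool" where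
  "reproducing_kernel D U ip K \<longleftrightarrow>
     (\<forall>x\<in>D. (\<lambda>y. K y x) \<in> U \<and> (\<forall>u\<in>U. u x = ip u (\<lambda>y. K y x)))"

text \<open>The finite set \<open>S\<close> plays the role of the distinct points of a kernel matrix.\<close>

definition strictly_positive_definite :: "'a set \<Rightarrow> ('a \<Rightarrow> 'a \<Rightarrow> real) \<Rightarrow> bool" where
  "strictly_positive_definite D K \<longleftrightarrow>
     (\<forall>x\<in>D. \<forall>y\<in>D. K x y = K y x) \<and>
     (\<forall>S c. finite S \<and> S \<subseteq> D \<and> (\<exists>p\<in>S. c p \<noteq> 0) \<longrightarrow>
        0 < (\<Sum>p\<in>S. \<Sum>q\<in>S. c p * c q * K p q))"

definition test_functionals ::
    "(real ^ 'n) set \<Rightarrow> ((real ^ 'n \<Rightarrow> real) \<Rightarrow> real ^ 'n \<Rightarrow> real) \<Rightarrow> ((real ^ 'n \<Rightarrow> real) \<Rightarrow> real) set" where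
  "test_functionals \<Omega> L = {(\<lambda>u. L u x) | x. x \<in> \<Omega>} \<union> {(\<lambda>u. u y) | y. y \<in> frontier \<Omega>}"

definition uniformly_bounded_functionals ::
    "('a \<Rightarrow> real) set \<Rightarrow> (('a \<Rightarrow> real) \<Rightarrow> ('a \<Rightarrow> real) \<Rightarrow> real) \<Rightarrow> (('a \<Rightarrow> real) \<Rightarrow> real) set \<Rightarrow> bool" where
  "uniformly_bounded_functionals U ip \<Lambda> \<longleftrightarrow>
     (\<exists>B. \<forall>\<nu>\<in>\<Lambda>. \<forall>u\<in>U. \<bar>\<nu> u\<bar> \<le> B * sqrt (ip u u))"

definition data_norm ::
    "(real ^ 'n) set \<Rightarrow> ((real ^ 'n \<Rightarrow> real) \<Rightarrow> real ^ 'n \<Rightarrow> real) \<Rightarrow> (real ^ 'n \<Rightarrow> real) \<Rightarrow> ereal" where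
  "data_norm \<Omega> L u = max (sup_norm \<Omega> (L u)) (sup_norm (frontier \<Omega>) u)"

definition distinct_nodes :: "'a set \<Rightarrow> nat \<Rightarrow> (nat \<Rightarrow> 'a) \<Rightarrow> bool" where
  "distinct_nodes \<Omega> M x \<longleftrightarrow> 1 \<le> M \<and> inj_on x {..<M} \<and> x ` {..<M} \<subseteq> \<Omega>"

definition trial_space :: "('a \<Rightarrow> 'a \<Rightarrow> real) \<Rightarrow> nat \<Rightarrow> (nat \<Rightarrow> 'a) \<Rightarrow> ('a \<Rightarrow> real) set" where
  "trial_space K M x = {(\<lambda>y. \<Sum>j<M. c j * K y (x j)) | c. True}"

definition lagrange_basis ::
    "('a \<Rightarrow> 'a \<Rightarrow> real) \<Rightarrow> nat \<Rightarrow> (nat \<Rightarrow> 'a) \<Rightarrow> (nat \<Rightarrow> 'a \<Rightarrow> real) \<Rightarrow> bool" where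
  "lagrange_basis K M x s \<longleftrightarrow>
     (\<forall>j<M. s j \<in> trial_space K M x \<and> (\<forall>k<M. s j (x k) = (if j = k then 1 else 0)))"

definition interpolant ::
    "('a \<Rightarrow> 'a \<Rightarrow> real) \<Rightarrow> nat \<Rightarrow> (nat \<Rightarrow> 'a) \<Rightarrow> ('a \<Rightarrow> real) \<Rightarrow> ('a \<Rightarrow> real) \<Rightarrow> bool" where
  "interpolant K M x u w \<longleftrightarrow> w \<in> trial_space K M x \<and> (\<forall>j<M. w (x j) = u (x j))"

definition stiffness_matrix ::
    "(nat \<Rightarrow> ('a \<Rightarrow> real) \<Rightarrow> real) \<Rightarrow> (nat \<Rightarrow> 'a \<Rightarrow> real) \<Rightarrow> nat \<Rightarrow> nat \<Rightarrow> real" where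
  "stiffness_matrix \<nu> s k j = \<nu> k (s j)"

text \<open>Existence of the Lagrange basis is part of the claim, so it cannot hold vacuously.\<close>

definition stable_stiffness ::
    "('a \<Rightarrow> 'a \<Rightarrow> real) \<Rightarrow> real \<Rightarrow> nat \<Rightarrow> (nat \<Rightarrow> 'a) \<Rightarrow> nat \<Rightarrow> (nat \<Rightarrow> ('a \<Rightarrow> real) \<Rightarrow> real) \<Rightarrow> bool" where
  "stable_stiffness K C M x N \<nu> \<longleftrightarrow>
     (\<exists>s. lagrange_basis K M x s) \<and>
     (\<forall>s. lagrange_basis K M x s \<longrightarrow>
        (\<forall>a. max_norm M a \<le> 2 * C * max_norm N (mat_vec M (stiffness_matrix \<nu> s) a)))"

text \<open>\<open>v\<close> minimizes the residual for \<open>u\<close> up to the factor \<open>C\<^sub>A\<close>, compared with \<open>w\<close>.\<close>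

definition approx_residual_min ::
    "real \<Rightarrow> nat \<Rightarrow> (nat \<Rightarrow> ('a \<Rightarrow> real) \<Rightarrow> real) \<Rightarrow> ('a \<Rightarrow> real) \<Rightarrow> ('a \<Rightarrow> real) \<Rightarrow> ('a \<Rightarrow> real) \<Rightarrow> bool" where
  "approx_residual_min C\<^sub>A N \<nu> u w v \<longleftrightarrow>
     max_norm N (\<lambda>k. \<nu> k (u - v)) \<le> C\<^sub>A * max_norm N (\<lambda>k. \<nu> k (u - w))"

definition residual_error_bound ::
    "(real ^ 'n) set \<Rightarrow> ((real ^ 'n \<Rightarrow> real) \<Rightarrow> real ^ 'n \<Rightarrow> real) \<Rightarrow> (real ^ 'n \<Rightarrow> real) set \<Rightarrow>
     (real ^ 'n \<Rightarrow> real ^ 'n \<Rightarrow> real) \<Rightarrow> real \<Rightarrow> nat \<Rightarrow> (nat \<Rightarrow> real ^ 'n) \<Rightarrow>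
     nat \<Rightarrow> (nat \<Rightarrow> (real ^ 'n \<Rightarrow> real) \<Rightarrow> real) \<Rightarrow> bool" where
  "residual_error_bound \<Omega> L U K C M x N \<nu> \<longleftrightarrow>
     (\<forall>C\<^sub>A\<ge>1. \<forall>u\<in>U. \<forall>w\<in>trial_space K M x. \<forall>v\<in>trial_space K M x.
        approx_residual_min C\<^sub>A N \<nu> u w v \<longrightarrow>
        sup_norm (closure \<Omega>) (u - v) \<le> ereal (C * (2 * C\<^sub>A + 3)) * data_norm \<Omega> L (u - w))"

definition good_selection ::
    "(real ^ 'n) set \<Rightarrow> ((real ^ 'n \<Rightarrow> real) \<Rightarrow> real ^ 'n \<Rightarrow> real) \<Rightarrow> (real ^ 'n \<Rightarrow> real) set \<Rightarrow>
     (real ^ 'n \<Rightarrow> real ^ 'n \<Rightarrow> real) \<Rightarrow> real \<Rightarrow> nat \<Rightarrow> (nat \<Rightarrow> real ^ 'n) \<Rightarrow>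
     nat \<Rightarrow> (nat \<Rightarrow> (real ^ 'n \<Rightarrow> real) \<Rightarrow> real) \<Rightarrow> bool" where
  "good_selection \<Omega> L U K C M x N \<nu> \<longleftrightarrow>
     1 \<le> N \<and> \<nu> ` {..<N} \<subseteq> test_functionals \<Omega> L \<and>
     stable_stiffness K C M x N \<nu> \<and>
     residual_error_bound \<Omega> L U K C M x N \<nu>"

end

theory Submission
  imports Defs
begin

text \<open>
  On the trial space \<open>U\<^sub>M\<close> a function is determined by its \<open>M\<close> nodal values, so a test functional
  \<open>\<lambda>\<close> acts on \<open>U\<^sub>M\<close> through the vector \<open>(\<lambda>(s\<^sub>1), \<dots>, \<lambda>(s\<^sub>M))\<close> of its values on the Lagrange
  basis. Uniform boundedness confines these vectors to a bounded subset of \<open>\<real>\<^sup>M\<close>, and a bounded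
  set has a finite net for every mesh width. Replacing \<open>\<lambda>\<close> by a nearby member \<open>\<nu>\<close> of the net changes
  \<open>\<lambda>(u)\<close> by at most the mesh width times the sum of the \<open>\<bar>u(x\<^sub>j)\<bar>\<close>, and well-posedness bounds
  these nodal values by \<open>C\<close> times the supremum of \<open>\<bar>\<lambda>(u)\<bar>\<close> over all test functionals. For a small
  enough mesh the change is at most half of that supremum, whence
  \<open>sup \<bar>\<lambda>(u)\<bar> \<le> 2 max\<^sub>k \<bar>\<nu>\<^sub>k(u)\<bar>\<close> for all \<open>u\<close> in \<open>U\<^sub>M\<close>
  (\<open>norming_selection_exists\<close>). Both estimates rest on this inequality.

  The stability estimate is this inequality combined with well-posedness, applied to
  \<open>u = \<Sum>\<^sub>j a\<^sub>j s\<^sub>j\<close>. For the error bound, let \<open>E\<close> be the supremum of \<open>\<bar>\<lambda>(u\<^sup>* - u\<^sub>M\<^sup>*)\<bar>\<close> over all test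
  functionals, and write \<open>v\<close> for the approximate residual minimizer. The selected functionals are at
  most \<open>E\<close> on \<open>u\<^sup>* - u\<^sub>M\<^sup>*\<close> and at most \<open>C\<^sub>A E\<close> on \<open>u\<^sup>* - v\<close>, hence at most \<open>(1 + C\<^sub>A) E\<close> on
  \<open>u\<^sub>M\<^sup>* - v\<close>, which lies in \<open>U\<^sub>M\<close>; there all test functionals are then at most
  \<open>2 (1 + C\<^sub>A) E\<close>. The triangle inequality gives \<open>(2 C\<^sub>A + 3) E\<close> on \<open>u\<^sup>* - v\<close>, and well-posedness
  supplies the last factor \<open>C\<close>.

  The convergence rate follows because \<open>E\<close> is dominated by the derivatives up to order two: inside
  the domain through the bounded coefficients of the operator, and on the boundary because a
  continuous function on the closure is bounded there by its supremum over the interior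
  (\<open>data_norm_bigo\<close>).
\<close>

section \<open>Interpolation by kernel translates\<close>

text \<open>Multiplying the \<open>p\<close>-th equation by \<open>c p\<close> and adding up turns the system into the quadratic form
  of the kernel at \<open>c\<close>, which is positive unless \<open>c\<close> vanishes.\<close>

lemma kernel_coefficients_unique:
  assumes K: "strictly_positive_definite D K" and S: "finite S" "S \<subseteq> D"
    and zero: "\<forall>p\<in>S. (\<Sum>q\<in>S. c q * K p q) = 0"
  shows "\<forall>q\<in>S. c q = 0"
proof (rule ccontr)
  assume "\<not> ?thesis"
  then have "0 < (\<Sum>p\<in>S. \<Sum>q\<in>S. c p * c q * K p q)"
    using K S unfolding strictly_positive_definite_def by blast
  also have "\<dots> = (\<Sum>p\<in>S. c p * (\<Sum>q\<in>S. c q * K p q))"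
    by (simp add: sum_distrib_left mult.assoc)
  also have "\<dots> = 0" using zero by simp
  finally show False by simp
qed

text \<open>Newton interpolation, adding one point \<open>z\<close> at a time. Subtracting from \<open>K(\<cdot>, z)\<close> its interpolant
  on the old points gives a combination \<open>V\<close> that vanishes on the old points. By uniqueness it
  cannot vanish at \<open>z\<close> as well, so the right multiple of it corrects the value at \<open>z\<close>.\<close>

lemma kernel_interpolation_solvable:
  assumes K: "strictly_positive_definite D K" and S: "finite S" "S \<subseteq> D"
  shows "\<exists>c. \<forall>p\<in>S. (\<Sum>q\<in>S. c q * K p q) = b p"
  using S
proof (induction S arbitrary: b rule: finite_induct)
  case empty
  then show ?case by simp
next
  case (insert z S)
  obtain c where c: "\<forall>p\<in>S. (\<Sum>q\<in>S. c q * K p q) = K p z"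
    using insert.IH[of "\<lambda>p. K p z"] insert.prems by auto
  obtain e where e: "\<forall>p\<in>S. (\<Sum>q\<in>S. e q * K p q) = b p"
    using insert.IH[of b] insert.prems by auto
  define d where "d = (\<lambda>q. if q = z then 1 else - c q)"
  define V where "V p = (\<Sum>q\<in>insert z S. d q * K p q)" for p
  have sum_upd: "(\<Sum>q\<in>insert z S. (if q = z then t else f q) * K p q)
      = t * K p z + (\<Sum>q\<in>S. f q * K p q)" for t f p
  proof -
    have "(\<Sum>q\<in>S. (if q = z then t else f q) * K p q) = (\<Sum>q\<in>S. f q * K p q)"
      using insert.hyps by (intro sum.cong) auto
    then show ?thesis using insert.hyps by simp
  qed
  have V: "V p = K p z - (\<Sum>q\<in>S. c q * K p q)" for p
    unfolding V_def d_def using sum_upd[where f = "\<lambda>q. - c q" and t = 1 and p = p] by (simp add: sum_negf)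
  have VS: "V p = 0" if "p \<in> S" for p using c that V by simp
  have "V z \<noteq> 0"
  proof
    assume "V z = 0"
    then have "\<forall>p\<in>insert z S. (\<Sum>q\<in>insert z S. d q * K p q) = 0"
      using VS unfolding V_def by blast
    then have "d z = 0"
      using kernel_coefficients_unique[OF K, of "insert z S" d] insert.hyps insert.prems by blast
    then show False by (simp add: d_def)
  qed
  \<comment> \<open>\<open>e\<close> interpolates on the old points; \<open>t\<close> is the multiple of \<open>V\<close> that repairs the value at \<open>z\<close>.\<close>
  define t where "t = (b z - (\<Sum>q\<in>S. e q * K z q)) / V z"
  have "(\<Sum>q\<in>insert z S. (if q = z then t else e q - t * c q) * K p q)
      = t * V p + (\<Sum>q\<in>S. e q * K p q)" for p
    unfolding sum_upd V by (simp add: algebra_simps sum_subtractf sum_distrib_left)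
  moreover have "t * V z + (\<Sum>q\<in>S. e q * K z q) = b z"
    using \<open>V z \<noteq> 0\<close> by (simp add: t_def)
  ultimately have "\<forall>p\<in>insert z S.
      (\<Sum>q\<in>insert z S. (if q = z then t else e q - t * c q) * K p q) = b p"
    using VS e by auto
  then show ?case by (rule exI[where x = "\<lambda>q. if q = z then t else e q - t * c q"])
qed

lemma trial_space_interpolation:
  assumes K: "strictly_positive_definite D K" and x: "distinct_nodes D M x"
  shows "\<exists>w\<in>trial_space K M x. \<forall>k<M. w (x k) = b k"
proof -
  have inj: "inj_on x {..<M}" and sub: "x ` {..<M} \<subseteq> D"
    using x by (auto simp: distinct_nodes_def)
  obtain c where c: "\<forall>p\<in>x ` {..<M}. (\<Sum>q\<in>x ` {..<M}. c q * K p q) = b (inv_into {..<M} x p)"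
    using kernel_interpolation_solvable[OF K, of "x ` {..<M}" "\<lambda>p. b (inv_into {..<M} x p)"] sub
    by auto
  have "(\<Sum>j<M. c (x j) * K (x k) (x j)) = b k" if "k < M" for k
    using c that inj by (simp add: sum.reindex)
  then show ?thesis
    by (intro bexI[where x = "\<lambda>y. \<Sum>j<M. c (x j) * K y (x j)"])
      (auto simp: trial_space_def intro!: exI[where x = "\<lambda>j. c (x j)"])
qed

lemma trial_space_eqI:
  assumes K: "strictly_positive_definite D K" and x: "distinct_nodes D M x"
    and u: "u \<in> trial_space K M x" and v: "v \<in> trial_space K M x"
    and eq: "\<And>k. k < M \<Longrightarrow> u (x k) = v (x k)"
  shows "u = v"
proof -
  have inj: "inj_on x {..<M}" and sub: "x ` {..<M} \<subseteq> D"
    using x by (auto simp: distinct_nodes_def)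
  obtain c where c: "u = (\<lambda>y. \<Sum>j<M. c j * K y (x j))" using u by (auto simp: trial_space_def)
  obtain e where e: "v = (\<lambda>y. \<Sum>j<M. e j * K y (x j))" using v by (auto simp: trial_space_def)
  define d where "d p = c (inv_into {..<M} x p) - e (inv_into {..<M} x p)" for p
  have "\<forall>p\<in>x ` {..<M}. (\<Sum>q\<in>x ` {..<M}. d q * K p q) = 0"
  proof
    fix p assume "p \<in> x ` {..<M}"
    then obtain k where k: "k < M" "p = x k" by auto
    have "(\<Sum>q\<in>x ` {..<M}. d q * K p q) = (\<Sum>j<M. (c j - e j) * K p (x j))"
      using inj by (simp add: sum.reindex d_def)
    also have "\<dots> = u p - v p" by (simp add: c e algebra_simps sum_subtractf)
    finally show "(\<Sum>q\<in>x ` {..<M}. d q * K p q) = 0" using eq k by simp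
  qed
  then have "\<forall>q\<in>x ` {..<M}. d q = 0"
    using kernel_coefficients_unique[OF K, of "x ` {..<M}" d] sub by blast
  then have "c j = e j" if "j < M" for j using that inj by (auto simp: d_def)
  then show ?thesis by (simp add: c e)
qed

section \<open>Spaces of functions and linear functionals\<close>

text \<open>Subspaces and linearity are formulated with explicit closure conditions since a test
  functional such as \<open>u \<mapsto> L u x\<close> need not be linear beyond \<open>U\<close>: on functions that are not
  twice differentiable the operator is arbitrary.\<close>

definition function_subspace :: "('a \<Rightarrow> real) set \<Rightarrow> bool" where
  "function_subspace U \<longleftrightarrow> (\<lambda>x. 0) \<in> U \<and>
     (\<forall>u\<in>U. \<forall>v\<in>U. (\<lambda>x. u x + v x) \<in> U) \<and> (\<forall>r. \<forall>u\<in>U. (\<lambda>x. r * u x) \<in> U)"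

definition linear_functional_on :: "('a \<Rightarrow> real) set \<Rightarrow> (('a \<Rightarrow> real) \<Rightarrow> real) \<Rightarrow> bool" where
  "linear_functional_on U \<nu> \<longleftrightarrow>
     (\<forall>u\<in>U. \<forall>v\<in>U. \<nu> (\<lambda>x. u x + v x) = \<nu> u + \<nu> v) \<and> (\<forall>r. \<forall>u\<in>U. \<nu> (\<lambda>x. r * u x) = r * \<nu> u)"

lemma function_subspaceD:
  assumes "function_subspace U"
  shows "(\<lambda>x. 0) \<in> U"
    and "u \<in> U \<Longrightarrow> v \<in> U \<Longrightarrow> (\<lambda>x. u x + v x) \<in> U"
    and "u \<in> U \<Longrightarrow> (\<lambda>x. r * u x) \<in> U"
  using assms by (auto simp: function_subspace_def)

lemma linear_functional_onD:
  assumes "linear_functional_on U \<nu>"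
  shows "u \<in> U \<Longrightarrow> v \<in> U \<Longrightarrow> \<nu> (\<lambda>x. u x + v x) = \<nu> u + \<nu> v"
    and "u \<in> U \<Longrightarrow> \<nu> (\<lambda>x. r * u x) = r * \<nu> u"
  using assms by (auto simp: linear_functional_on_def)

lemma function_subspace_sum:
  assumes "function_subspace U" and "\<And>j. j < n \<Longrightarrow> s j \<in> U"
  shows "(\<lambda>y. \<Sum>j<(n::nat). a j * s j y) \<in> U"
  using assms(2)
  by (induction n) (use assms(1) in \<open>auto simp: function_subspace_def\<close>)

lemma linear_functional_sum:
  assumes U: "function_subspace U" and \<nu>: "linear_functional_on U \<nu>" and "\<And>j. j < n \<Longrightarrow> s j \<in> U"
  shows "\<nu> (\<lambda>y. \<Sum>j<(n::nat). a j * s j y) = (\<Sum>j<n. a j * \<nu> (s j))"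
  using assms(3)
proof (induction n)
  case 0
  have "\<nu> (\<lambda>x. 0 * (0::real)) = 0 * \<nu> (\<lambda>x. 0)"
    by (rule linear_functional_onD(2)[OF \<nu> function_subspaceD(1)[OF U]])
  then show ?case by simp
next
  case (Suc n)
  have "(\<lambda>y. \<Sum>j<n. a j * s j y) \<in> U" "(\<lambda>y. a n * s n y) \<in> U"
    using function_subspace_sum[OF U, of n s a] Suc.prems U by (auto simp: function_subspace_def)
  then show ?case
    using Suc \<nu> by (simp add: linear_functional_on_def)
qed

lemma function_subspace_diff:
  assumes "function_subspace U" "u \<in> U" "v \<in> U"
  shows "u - v \<in> U"
proof -
  have "(\<lambda>x. u x + (-1) * v x) \<in> U"
    by (intro function_subspaceD(2)[OF assms(1)] function_subspaceD(3)[OF assms(1)] assms(2,3))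
  then show ?thesis by (simp add: fun_diff_def)
qed

lemma linear_functional_diff:
  assumes U: "function_subspace U" and \<nu>: "linear_functional_on U \<nu>" and uv: "u \<in> U" "v \<in> U"
  shows "\<nu> (u - v) = \<nu> u - \<nu> v"
proof -
  have m: "(\<lambda>x. (-1) * v x) \<in> U" by (rule function_subspaceD(3)[OF U uv(2)])
  have "\<nu> (\<lambda>x. u x + (-1) * v x) = \<nu> u + \<nu> (\<lambda>x. (-1) * v x)"
    by (rule linear_functional_onD(1)[OF \<nu> uv(1) m])
  also have "\<nu> (\<lambda>x. (-1) * v x) = (-1) * \<nu> v"
    by (rule linear_functional_onD(2)[OF \<nu> uv(2)])
  finally show ?thesis by (simp add: fun_diff_def)
qed

lemma function_subspace_trial_space: "function_subspace (trial_space K M x)"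
  unfolding function_subspace_def
proof (intro conjI ballI allI)
  show "(\<lambda>x. 0) \<in> trial_space K M x"
    by (auto simp: trial_space_def intro!: exI[where x = "\<lambda>_. 0"])
next
  fix u v assume "u \<in> trial_space K M x" "v \<in> trial_space K M x"
  then obtain c e where "u = (\<lambda>y. \<Sum>j<M. c j * K y (x j))" "v = (\<lambda>y. \<Sum>j<M. e j * K y (x j))"
    by (auto simp: trial_space_def)
  then show "(\<lambda>x. u x + v x) \<in> trial_space K M x"
    by (auto simp: trial_space_def algebra_simps sum.distrib intro!: exI[where x = "\<lambda>j. c j + e j"])
next
  fix r u assume "u \<in> trial_space K M x"
  then obtain c where "u = (\<lambda>y. \<Sum>j<M. c j * K y (x j))"
    by (auto simp: trial_space_def)
  then show "(\<lambda>x. r * u x) \<in> trial_space K M x"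
    by (auto simp: trial_space_def algebra_simps sum_distrib_left intro!: exI[where x = "\<lambda>j. r * c j"])
qed

lemma trial_space_subset:
  assumes U: "function_subspace U" and K: "reproducing_kernel D U ip K" and x: "distinct_nodes D M x"
  shows "trial_space K M x \<subseteq> U"
proof
  fix u assume "u \<in> trial_space K M x"
  then obtain c where u: "u = (\<lambda>y. \<Sum>j<M. c j * K y (x j))"
    by (auto simp: trial_space_def)
  have "(\<lambda>y. K y (x j)) \<in> U" if "j < M" for j
    using K x that by (auto simp: reproducing_kernel_def distinct_nodes_def)
  then show "u \<in> U" unfolding u by (rule function_subspace_sum[OF U])
qed

lemma lagrange_basis_exists:
  assumes K: "strictly_positive_definite D K" and x: "distinct_nodes D M x"
  shows "\<exists>s. lagrange_basis K M x s"
proof -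
  have "\<exists>w\<in>trial_space K M x. \<forall>k<M. w (x k) = (if j = k then 1 else 0)" for j
    by (rule trial_space_interpolation[OF K x])
  then have "\<forall>j. \<exists>w. w \<in> trial_space K M x \<and> (\<forall>k<M. w (x k) = (if j = k then 1 else 0))"
    unfolding Bex_def by (rule allI)
  then have "\<exists>s. \<forall>j. s j \<in> trial_space K M x \<and> (\<forall>k<M. s j (x k) = (if j = k then 1 else 0))"
    by (rule choice)
  then show ?thesis unfolding lagrange_basis_def by blast
qed

lemma lagrange_combination:
  assumes s: "lagrange_basis K M x s"
  shows "(\<lambda>y. \<Sum>j<M. a j * s j y) \<in> trial_space K M x"
    and "k < M \<Longrightarrow> (\<Sum>j<M. a j * s j (x k)) = a k"
proof -
  show "(\<lambda>y. \<Sum>j<M. a j * s j y) \<in> trial_space K M x"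
    using s by (intro function_subspace_sum function_subspace_trial_space) (auto simp: lagrange_basis_def)
  assume "k < M"
  then have "(\<Sum>j<M. a j * s j (x k)) = (\<Sum>j<M. if j = k then a j else 0)"
    using s by (intro sum.cong) (auto simp: lagrange_basis_def)
  then show "(\<Sum>j<M. a j * s j (x k)) = a k" using \<open>k < M\<close> by simp
qed

lemma lagrange_representation:
  assumes K: "strictly_positive_definite D K" and x: "distinct_nodes D M x"
    and s: "lagrange_basis K M x s" and u: "u \<in> trial_space K M x"
  shows "u = (\<lambda>y. \<Sum>j<M. u (x j) * s j y)"
  using lagrange_combination[OF s, where a = "\<lambda>j. u (x j)"]
  by (intro trial_space_eqI[OF K x u]) auto

section \<open>Finitely many functionals that nearly realise the supremum\<close>

text \<open>Total boundedness of a bounded subset of \<open>\<real>\<^sup>J\<close>, by rounding: dividing each coordinate by \<open>\<eta>\<close> and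
  taking the floor gives only finitely many integer vectors, and one \<open>l\<close> is kept for each of them.\<close>

lemma finite_net_of_functionals:
  fixes f :: "'a \<Rightarrow> 'b \<Rightarrow> real"
  assumes J: "finite J" and \<eta>: "\<eta> > 0" and bd: "\<And>l j. l \<in> \<Lambda> \<Longrightarrow> j \<in> J \<Longrightarrow> \<bar>f l j\<bar> \<le> B"
  shows "\<exists>F\<subseteq>\<Lambda>. finite F \<and> (\<forall>l\<in>\<Lambda>. \<exists>n\<in>F. \<forall>j\<in>J. \<bar>f l j - f n j\<bar> \<le> \<eta>)"
proof -
  define g where "g l = restrict (\<lambda>j. \<lfloor>f l j / \<eta>\<rfloor>) J" for l
  have "g ` \<Lambda> \<subseteq> PiE J (\<lambda>_. {\<lfloor>- B / \<eta>\<rfloor>..\<lfloor>B / \<eta>\<rfloor>})"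
  proof clarify
    fix l assume l: "l \<in> \<Lambda>"
    have "\<lfloor>- B / \<eta>\<rfloor> \<le> \<lfloor>f l j / \<eta>\<rfloor> \<and> \<lfloor>f l j / \<eta>\<rfloor> \<le> \<lfloor>B / \<eta>\<rfloor>" if "j \<in> J" for j
      using bd[OF l that] \<eta> by (intro conjI floor_mono divide_right_mono) auto
    then show "g l \<in> PiE J (\<lambda>_. {\<lfloor>- B / \<eta>\<rfloor>..\<lfloor>B / \<eta>\<rfloor>})" by (auto simp: g_def)
  qed
  then have "finite (g ` \<Lambda>)" by (rule finite_subset) (intro finite_PiE J, simp)
  then obtain F where F: "F \<subseteq> \<Lambda>" "finite F" "g ` \<Lambda> = g ` F"
    using finite_subset_image[of "g ` \<Lambda>" g \<Lambda>] by auto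
  have "\<exists>n\<in>F. \<forall>j\<in>J. \<bar>f l j - f n j\<bar> \<le> \<eta>" if l: "l \<in> \<Lambda>" for l
  proof -
    obtain n where n: "n \<in> F" "g l = g n" using F l by (metis imageE imageI)
    have "\<bar>f l j - f n j\<bar> \<le> \<eta>" if "j \<in> J" for j
    proof -
      have "\<lfloor>f l j / \<eta>\<rfloor> = \<lfloor>f n j / \<eta>\<rfloor>"
        using fun_cong[OF n(2), of j] that by (simp add: g_def)
      then have "\<bar>f l j / \<eta> - f n j / \<eta>\<bar> \<le> 1" by linarith
      then have "\<bar>f l j - f n j\<bar> / \<eta> \<le> 1"
        using \<eta> by (simp add: diff_divide_distrib[symmetric])
      then show ?thesis using \<eta> by (simp add: pos_divide_le_eq)
    qed
    then show ?thesis using n by blast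
  qed
  then show ?thesis using F by blast
qed

lemma max_norm_ge: "k < n \<Longrightarrow> \<bar>v k\<bar> \<le> max_norm n v"
  by (simp add: max_norm_def)

lemma max_norm_le: "1 \<le> n \<Longrightarrow> (\<And>k. k < n \<Longrightarrow> \<bar>v k\<bar> \<le> r) \<Longrightarrow> max_norm n v \<le> r"
  unfolding max_norm_def by (subst Max_le_iff) (auto simp: lessThan_empty_iff)

text \<open>In approximation theory, \<open>\<nu>\<close> is a norming set for \<open>V\<close>, with norming constant 2. This constant
  is the factor 2 in the stability and error bounds.\<close>

definition norming_selection ::
    "(('a \<Rightarrow> real) \<Rightarrow> real) set \<Rightarrow> ('a \<Rightarrow> real) set \<Rightarrow> nat \<Rightarrow> (nat \<Rightarrow> ('a \<Rightarrow> real) \<Rightarrow> real) \<Rightarrow> bool" where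
  "norming_selection \<Lambda> V N \<nu> \<longleftrightarrow> 1 \<le> N \<and> \<nu> ` {..<N} \<subseteq> \<Lambda> \<and>
     (\<forall>u\<in>V. \<forall>l\<in>\<Lambda>. \<bar>l u\<bar> \<le> 2 * max_norm N (\<lambda>k. \<nu> k u))"

text \<open>Here \<open>coeff\<close> is what remains of well-posedness in coordinates: it makes the supremum \<open>R\<close> of all
  \<open>\<bar>l u\<bar>\<close> control the coefficients of \<open>u\<close>. A net of mesh \<open>\<eta>\<close> then yields
  \<open>R \<le> max\<^sub>k \<bar>\<nu>\<^sub>k u\<bar> + M C R \<eta>\<close>, and the last term can be absorbed into the left-hand side
  once \<open>M C \<eta> \<le> 1/2\<close>.\<close>

lemma norming_selection_exists:
  fixes s :: "nat \<Rightarrow> 'a \<Rightarrow> real"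
  assumes "\<Lambda> \<noteq> {}" and C: "C > 0"
    and lin: "\<And>l a. l \<in> \<Lambda> \<Longrightarrow> l (\<lambda>y. \<Sum>j<M. a j * s j y) = (\<Sum>j<M. a j * l (s j))"
    and bd: "\<And>l j. l \<in> \<Lambda> \<Longrightarrow> j < M \<Longrightarrow> \<bar>l (s j)\<bar> \<le> B"
    and coeff: "\<And>a r j. \<forall>l\<in>\<Lambda>. \<bar>l (\<lambda>y. \<Sum>j<M. a j * s j y)\<bar> \<le> r \<Longrightarrow> j < M \<Longrightarrow> \<bar>a j\<bar> \<le> C * r"
  shows "\<exists>N \<nu>. norming_selection \<Lambda> (range (\<lambda>a y. \<Sum>j<M. a j * s j y)) N \<nu>"
proof -
  \<comment> \<open>\<open>M + 1\<close> instead of \<open>M\<close> avoids a division by zero for the empty basis.\<close>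
  define \<eta> where "\<eta> = 1 / (2 * C * (real M + 1))"
  have \<eta>: "\<eta> > 0" using C by (simp add: \<eta>_def)
  have "\<exists>F\<subseteq>\<Lambda>. finite F \<and> (\<forall>l\<in>\<Lambda>. \<exists>n\<in>F. \<forall>j\<in>{..<M}. \<bar>l (s j) - n (s j)\<bar> \<le> \<eta>)"
    using bd by (intro finite_net_of_functionals \<eta>) auto
  then obtain F where F: "F \<subseteq> \<Lambda>" "finite F"
    and net: "\<And>l. l \<in> \<Lambda> \<Longrightarrow> \<exists>n\<in>F. \<forall>j\<in>{..<M}. \<bar>l (s j) - n (s j)\<bar> \<le> \<eta>" by blast
  have "F \<noteq> {}" using net \<open>\<Lambda> \<noteq> {}\<close> by blast
  obtain \<nu> where \<nu>: "bij_betw \<nu> {..<card F} F"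
    using ex_bij_betw_nat_finite[OF F(2)] by (auto simp: atLeast0LessThan)
  have "\<bar>l u\<bar> \<le> 2 * max_norm (card F) (\<lambda>k. \<nu> k u)"
    if l: "l \<in> \<Lambda>" and u: "u = (\<lambda>y. \<Sum>j<M. a j * s j y)" for l u a
  proof -
    define m where "m = max_norm (card F) (\<lambda>k. \<nu> k u)"
    define R where "R = (SUP l\<in>\<Lambda>. \<bar>l u\<bar>)"
    have "\<bar>l u\<bar> \<le> (\<Sum>j<M. \<bar>a j\<bar> * B)" if "l \<in> \<Lambda>" for l
      unfolding u lin[OF that] using bd[OF that]
      by (intro order_trans[OF sum_abs] sum_mono) (auto simp: abs_mult intro!: mult_left_mono)
    then have bdd: "bdd_above ((\<lambda>l. \<bar>l u\<bar>) ` \<Lambda>)" by (auto intro!: bdd_aboveI2)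
    \<comment> \<open>Absorbing \<open>R / 2\<close> requires a finite \<open>R\<close>, which is what \<open>bdd\<close> provides.\<close>
    have R: "\<bar>l u\<bar> \<le> R" if "l \<in> \<Lambda>" for l
      unfolding R_def using bdd that by (rule cSUP_upper2[rotated 2, OF order_refl])
    have R0: "0 \<le> R" using R[OF l] by linarith
    have a: "\<bar>a j\<bar> \<le> C * R" if "j < M" for j
      using coeff[of a R, OF _ that] R unfolding u by blast
    have "\<bar>l u\<bar> \<le> m + R / 2" if l: "l \<in> \<Lambda>" for l
    proof -
      obtain n where n: "n \<in> F" "\<And>j. j < M \<Longrightarrow> \<bar>l (s j) - n (s j)\<bar> \<le> \<eta>"
        using net[OF l] by auto
      have "\<bar>l u - n u\<bar> = \<bar>\<Sum>j<M. a j * (l (s j) - n (s j))\<bar>"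
        using lin[OF l] lin[of n] n(1) F(1) by (auto simp: u algebra_simps sum_subtractf)
      also have "\<dots> \<le> (\<Sum>j<M. C * R * \<eta>)"
        using a n(2) C R0
        by (intro order_trans[OF sum_abs] sum_mono) (auto simp: abs_mult intro!: mult_mono)
      also have "\<dots> = (real M / (real M + 1)) * (R / 2)"
        using C by (simp add: \<eta>_def)
      also have "\<dots> \<le> 1 * (R / 2)"
        using R0 by (intro mult_right_mono) auto
      finally have "\<bar>l u - n u\<bar> \<le> R / 2" by simp
      moreover obtain k where "k < card F" "n = \<nu> k"
        using \<nu> n(1) by (auto simp: bij_betw_def)
      then have "\<bar>n u\<bar> \<le> m"
        using max_norm_ge[of k "card F" "\<lambda>k. \<nu> k u"] by (simp add: m_def)
      ultimately show ?thesis by linarith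
    qed
    then have "R \<le> m + R / 2"
      unfolding R_def using \<open>\<Lambda> \<noteq> {}\<close> by (intro cSUP_least) auto
    then show ?thesis using R[OF l] by (simp add: m_def)
  qed
  moreover have "1 \<le> card F" using F \<open>F \<noteq> {}\<close> by (simp add: Suc_le_eq card_gt_0_iff)
  moreover have "\<nu> ` {..<card F} \<subseteq> \<Lambda>" using \<nu> F by (auto simp: bij_betw_def)
  ultimately show ?thesis
    unfolding norming_selection_def by (intro exI[of _ "card F"] exI[of _ \<nu>]) auto
qed

section \<open>Linearity of the differential operator\<close>

text \<open>A partial derivative depends only on the values near the point. This is needed because the first
  partial derivatives of a sum are the sums of the partial derivatives only inside \<open>\<Omega>\<close>.\<close>

lemma partial_deriv_cong:
  assumes "open \<Omega>" "x \<in> \<Omega>" and eq: "\<And>y. y \<in> \<Omega> \<Longrightarrow> f y = g y"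
  shows "partial_deriv i f x = partial_deriv i g x"
  unfolding partial_deriv_def
proof (rule deriv_cong_ev)
  have "((\<lambda>t. x + t *\<^sub>R axis i 1) \<longlongrightarrow> x + 0 *\<^sub>R axis i 1) (nhds (0::real))"
    by (intro tendsto_intros filterlim_ident)
  then have "\<forall>\<^sub>F t in nhds (0::real). x + t *\<^sub>R axis i 1 \<in> \<Omega>"
    using assms by (simp add: tendsto_def)
  then show "\<forall>\<^sub>F t in nhds 0. f (x + t *\<^sub>R axis i 1) = g (x + t *\<^sub>R axis i 1)"
    by eventually_elim (rule eq)
qed simp

lemma partial_deriv_add:
  assumes "has_partial_deriv_on i u \<Omega>" "has_partial_deriv_on i v \<Omega>" "x \<in> \<Omega>"
  shows "partial_deriv i (\<lambda>x. u x + v x) x = partial_deriv i u x + partial_deriv i v x"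
  using assms unfolding partial_deriv_def has_partial_deriv_on_def by (intro deriv_add) auto

lemma partial_deriv_cmult:
  assumes "has_partial_deriv_on i u \<Omega>" "x \<in> \<Omega>"
  shows "partial_deriv i (\<lambda>x. r * u x) x = r * partial_deriv i u x"
  using assms unfolding partial_deriv_def has_partial_deriv_on_def by (intro deriv_cmult) auto

lemma elliptic_operator_linear:
  assumes L: "elliptic_operator \<Omega> L" and "open \<Omega>" and U: "function_subspace U"
    and C2: "\<And>u. u \<in> U \<Longrightarrow> C2_on \<Omega> u" and x: "x \<in> \<Omega>"
  shows "linear_functional_on U (\<lambda>u. L u x)"
proof -
  obtain a b c where Lx: "\<And>u. C2_on \<Omega> u \<Longrightarrow>
      L u x = (\<Sum>i\<in>UNIV. \<Sum>j\<in>UNIV. a i j x * partial_deriv i (partial_deriv j u) x)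
                 + (\<Sum>i\<in>UNIV. b i x * partial_deriv i u x) + c x * u x"
    using L x unfolding elliptic_operator_def by blast
  have d: "has_partial_deriv_on i u \<Omega>" "has_partial_deriv_on i (partial_deriv j u) \<Omega>" if "u \<in> U" for i j u
    using C2[OF that] by (auto simp: C2_on_def)
  show ?thesis
    unfolding linear_functional_on_def
  proof (intro conjI ballI allI)
    fix u v assume uv: "u \<in> U" "v \<in> U"
    have "partial_deriv i (partial_deriv j (\<lambda>x. u x + v x)) x
        = partial_deriv i (\<lambda>x. partial_deriv j u x + partial_deriv j v x) x" for i j
      using d uv by (intro partial_deriv_cong[OF \<open>open \<Omega>\<close> x] partial_deriv_add)
    then have "partial_deriv i (partial_deriv j (\<lambda>x. u x + v x)) x
        = partial_deriv i (partial_deriv j u) x + partial_deriv i (partial_deriv j v) x" for i j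
      using partial_deriv_add[OF d(2)[OF uv(1)] d(2)[OF uv(2)] x] by simp
    moreover have "partial_deriv i (\<lambda>x. u x + v x) x = partial_deriv i u x + partial_deriv i v x" for i
      by (rule partial_deriv_add[OF d(1)[OF uv(1)] d(1)[OF uv(2)] x])
    moreover have "(\<lambda>x. u x + v x) \<in> U" using U uv by (simp add: function_subspace_def)
    ultimately show "L (\<lambda>x. u x + v x) x = L u x + L v x"
      using Lx C2 uv by (simp add: algebra_simps sum.distrib)
  next
    fix r u assume u: "u \<in> U"
    have "partial_deriv i (partial_deriv j (\<lambda>x. r * u x)) x
        = partial_deriv i (\<lambda>x. r * partial_deriv j u x) x" for i j
      using d u by (intro partial_deriv_cong[OF \<open>open \<Omega>\<close> x] partial_deriv_cmult)
    then have "partial_deriv i (partial_deriv j (\<lambda>x. r * u x)) x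
        = r * partial_deriv i (partial_deriv j u) x" for i j
      using partial_deriv_cmult[OF d(2)[OF u] x] by simp
    moreover have "partial_deriv i (\<lambda>x. r * u x) x = r * partial_deriv i u x" for i
      by (rule partial_deriv_cmult[OF d(1)[OF u] x])
    moreover have "(\<lambda>x. r * u x) \<in> U" using U u by (simp add: function_subspace_def)
    ultimately show "L (\<lambda>x. r * u x) x = r * L u x"
      using Lx C2 u by (simp add: algebra_simps sum_distrib_left)
  qed
qed

section \<open>Supremum norms\<close>

lemma sup_norm_le_iff: "sup_norm S f \<le> ereal r \<longleftrightarrow> (\<forall>x\<in>S. \<bar>f x\<bar> \<le> r)"
  by (simp add: sup_norm_def SUP_le_iff)

text \<open>The link between the two descriptions of the data: the norm of \<open>(L u, u)\<close> is the supremum of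
  all test functionals at \<open>u\<close>.\<close>

lemma data_norm_le_iff:
  "data_norm \<Omega> L u \<le> ereal r \<longleftrightarrow> (\<forall>l\<in>test_functionals \<Omega> L. \<bar>l u\<bar> \<le> r)"
  by (auto simp: data_norm_def sup_norm_le_iff test_functionals_def)

lemma data_norm_nonneg:
  assumes "\<Omega> \<noteq> {}"
  shows "0 \<le> data_norm \<Omega> L u"
proof -
  obtain x where "x \<in> \<Omega>" using assms by blast
  then have "ereal \<bar>L u x\<bar> \<le> data_norm \<Omega> L u"
    unfolding data_norm_def sup_norm_def by (auto intro!: le_max_iff_disj[THEN iffD2] SUP_upper)
  then show ?thesis by (rule order_trans[rotated]) simp
qed

lemma data_norm_finite:
  assumes "\<Omega> \<noteq> {}" and "\<forall>l\<in>test_functionals \<Omega> L. \<bar>l u\<bar> \<le> B"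
  obtains r where "data_norm \<Omega> L u = ereal r" and "0 \<le> r"
proof -
  have "0 \<le> data_norm \<Omega> L u" by (rule data_norm_nonneg[OF assms(1)])
  moreover have "data_norm \<Omega> L u \<le> ereal B" using assms data_norm_le_iff by blast
  ultimately show thesis by (cases "data_norm \<Omega> L u") (auto intro: that)
qed

text \<open>Finitely many \<open>O\<close>-bounds hold with a common constant; the sum of the absolute values of the
  individual constants will do.\<close>

lemma sup_norm_bigo_uniform:
  assumes "finite I" and "\<And>i. i \<in> I \<Longrightarrow> sup_norm_bigo S (f i) \<epsilon>"
  shows "\<exists>c. \<forall>\<^sub>F n in sequentially. \<forall>i\<in>I. \<forall>x\<in>S. \<bar>f i n x\<bar> \<le> c * \<bar>\<epsilon> n\<bar>"
proof -
  have "\<forall>i\<in>I. \<exists>c. \<forall>\<^sub>F n in sequentially. \<forall>x\<in>S. \<bar>f i n x\<bar> \<le> c * \<bar>\<epsilon> n\<bar>"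
    using assms(2) by (simp add: sup_norm_bigo_def sup_norm_le_iff)
  then obtain c where c: "\<forall>i\<in>I. \<forall>\<^sub>F n in sequentially. \<forall>x\<in>S. \<bar>f i n x\<bar> \<le> c i * \<bar>\<epsilon> n\<bar>"
    by (rule bchoice[THEN exE])
  have "\<forall>\<^sub>F n in sequentially. \<forall>i\<in>I. \<forall>x\<in>S. \<bar>f i n x\<bar> \<le> c i * \<bar>\<epsilon> n\<bar>"
    using c assms(1) by (simp add: eventually_ball_finite_distrib)
  then have "\<forall>\<^sub>F n in sequentially. \<forall>i\<in>I. \<forall>x\<in>S. \<bar>f i n x\<bar> \<le> (\<Sum>i\<in>I. \<bar>c i\<bar>) * \<bar>\<epsilon> n\<bar>"
  proof eventually_elim
    case (elim n)
    have "\<bar>f i n x\<bar> \<le> (\<Sum>i\<in>I. \<bar>c i\<bar>) * \<bar>\<epsilon> n\<bar>" if "i \<in> I" "x \<in> S" for i x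
    proof -
      have "c i \<le> (\<Sum>i\<in>I. \<bar>c i\<bar>)"
        using member_le_sum[of i I "\<lambda>i. \<bar>c i\<bar>"] assms(1) that by auto
      then have "c i * \<bar>\<epsilon> n\<bar> \<le> (\<Sum>i\<in>I. \<bar>c i\<bar>) * \<bar>\<epsilon> n\<bar>"
        by (rule mult_right_mono) simp
      then show ?thesis using elim that by fastforce
    qed
    then show ?case by blast
  qed
  then show ?thesis by blast
qed

text \<open>Each term of \<open>L (e n)\<close> is a bounded coefficient times a derivative of order at most two. On the
  boundary, which the \<open>O\<close>-bounds do not reach, the bound for \<open>e n\<close> itself carries over from the interior by
  continuity.\<close>

lemma data_norm_bigo:
  fixes \<Omega> :: "(real ^ 'n) set"
  assumes L: "elliptic_operator \<Omega> L"
    and C2: "\<And>n. C2_on \<Omega> (e n)" and cont: "\<And>n. continuous_on (closure \<Omega>) (e n)"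
    and e0: "sup_norm_bigo \<Omega> e \<epsilon>"
    and e1: "\<And>i. sup_norm_bigo \<Omega> (\<lambda>n. partial_deriv i (e n)) \<epsilon>"
    and e2: "\<And>i j. sup_norm_bigo \<Omega> (\<lambda>n. partial_deriv i (partial_deriv j (e n))) \<epsilon>"
  shows "\<exists>c. \<forall>\<^sub>F n in sequentially. data_norm \<Omega> L (e n) \<le> ereal (c * \<bar>\<epsilon> n\<bar>)"
proof -
  obtain a b c where a: "\<And>i j. bounded (a i j ` \<Omega>)" and b: "\<And>i. bounded (b i ` \<Omega>)"
    and c: "bounded (c ` \<Omega>)"
    and Lx: "\<And>u x. C2_on \<Omega> u \<Longrightarrow> x \<in> \<Omega> \<Longrightarrow>
      L u x = (\<Sum>i\<in>UNIV. \<Sum>j\<in>UNIV. a i j x * partial_deriv i (partial_deriv j u) x)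
                 + (\<Sum>i\<in>UNIV. b i x * partial_deriv i u x) + c x * u x"
    using L unfolding elliptic_operator_def by blast
  have "\<forall>i j. \<exists>A. \<forall>x\<in>\<Omega>. \<bar>a i j x\<bar> \<le> A" using a by (simp add: bounded_iff)
  then obtain A where A: "\<And>i j x. x \<in> \<Omega> \<Longrightarrow> \<bar>a i j x\<bar> \<le> A i j" by metis
  have "\<forall>i. \<exists>A. \<forall>x\<in>\<Omega>. \<bar>b i x\<bar> \<le> A" using b by (simp add: bounded_iff)
  then obtain B where B: "\<And>i x. x \<in> \<Omega> \<Longrightarrow> \<bar>b i x\<bar> \<le> B i" by metis
  obtain G where G: "\<And>x. x \<in> \<Omega> \<Longrightarrow> \<bar>c x\<bar> \<le> G" using c by (auto simp: bounded_iff)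
  obtain k0 where k0: "\<forall>\<^sub>F n in sequentially. \<forall>x\<in>\<Omega>. \<bar>e n x\<bar> \<le> k0 * \<bar>\<epsilon> n\<bar>"
    using e0 by (auto simp: sup_norm_bigo_def sup_norm_le_iff)
  obtain k1 where k1: "\<forall>\<^sub>F n in sequentially. \<forall>i\<in>UNIV. \<forall>x\<in>\<Omega>. \<bar>partial_deriv i (e n) x\<bar> \<le> k1 * \<bar>\<epsilon> n\<bar>"
    using sup_norm_bigo_uniform[of "UNIV :: 'n set" \<Omega> "\<lambda>i n. partial_deriv i (e n)" \<epsilon>] e1 by auto
  obtain k2 where k2: "\<forall>\<^sub>F n in sequentially. \<forall>ij\<in>UNIV. \<forall>x\<in>\<Omega>.
      \<bar>partial_deriv (fst ij) (partial_deriv (snd ij) (e n)) x\<bar> \<le> k2 * \<bar>\<epsilon> n\<bar>"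
    using sup_norm_bigo_uniform[of "UNIV :: ('n \<times> 'n) set" \<Omega>
        "\<lambda>ij n. partial_deriv (fst ij) (partial_deriv (snd ij) (e n))" \<epsilon>] e2 by auto
  define T where "T = (\<Sum>i\<in>UNIV. \<Sum>j\<in>UNIV. A i j * k2) + (\<Sum>i\<in>UNIV. B i * k1) + G * k0"
  have "\<forall>\<^sub>F n in sequentially. data_norm \<Omega> L (e n) \<le> ereal (max T k0 * \<bar>\<epsilon> n\<bar>)"
    using k0 k1 k2
  proof eventually_elim
    case (elim n)
    have prod: "\<bar>p * q\<bar> \<le> P * Q" if "\<bar>p\<bar> \<le> P" "\<bar>q\<bar> \<le> Q" for p q P Q :: real
      unfolding abs_mult using that by (intro mult_mono) auto
    have up: "t * \<bar>\<epsilon> n\<bar> \<le> max T k0 * \<bar>\<epsilon> n\<bar>" if "t \<le> max T k0" for t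
      using that by (intro mult_right_mono) auto
    have "\<bar>L (e n) x\<bar> \<le> max T k0 * \<bar>\<epsilon> n\<bar>" if x: "x \<in> \<Omega>" for x
    proof -
      have s2: "\<bar>\<Sum>i\<in>UNIV. \<Sum>j\<in>UNIV. a i j x * partial_deriv i (partial_deriv j (e n)) x\<bar>
          \<le> (\<Sum>i\<in>UNIV. \<Sum>j\<in>UNIV. A i j * (k2 * \<bar>\<epsilon> n\<bar>))"
        using elim(3) A x
        by (intro order_trans[OF sum_abs] sum_mono prod) fastforce+
      have s1: "\<bar>\<Sum>i\<in>UNIV. b i x * partial_deriv i (e n) x\<bar> \<le> (\<Sum>i\<in>UNIV. B i * (k1 * \<bar>\<epsilon> n\<bar>))"
        using elim(2) B x by (intro order_trans[OF sum_abs] sum_mono prod) fastforce+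
      have s0: "\<bar>c x * e n x\<bar> \<le> G * (k0 * \<bar>\<epsilon> n\<bar>)"
        using elim(1) G x by (intro prod) auto
      have "\<bar>L (e n) x\<bar> \<le> (\<Sum>i\<in>UNIV. \<Sum>j\<in>UNIV. A i j * (k2 * \<bar>\<epsilon> n\<bar>))
          + (\<Sum>i\<in>UNIV. B i * (k1 * \<bar>\<epsilon> n\<bar>)) + G * (k0 * \<bar>\<epsilon> n\<bar>)"
        unfolding Lx[OF C2 x] using s0 s1 s2 by linarith
      also have "\<dots> = T * \<bar>\<epsilon> n\<bar>"
        by (simp add: T_def sum_distrib_right distrib_right mult.assoc)
      finally show ?thesis using up[of T] by simp
    qed
    moreover have "\<bar>e n y\<bar> \<le> max T k0 * \<bar>\<epsilon> n\<bar>" if "y \<in> frontier \<Omega>" for y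
    proof -
      have "\<bar>e n y\<bar> \<le> k0 * \<bar>\<epsilon> n\<bar>"
      proof (rule continuous_le_on_closure[of \<Omega> "\<lambda>y. \<bar>e n y\<bar>"])
        show "continuous_on (closure \<Omega>) (\<lambda>y. \<bar>e n y\<bar>)"
          by (rule continuous_on_rabs[OF cont])
        show "y \<in> closure \<Omega>" using that by (simp add: frontier_def)
        show "\<bar>e n x\<bar> \<le> k0 * \<bar>\<epsilon> n\<bar>" if "x \<in> \<Omega>" for x
          using elim(1) that by blast
      qed
      then show ?thesis using up[of k0] by simp
    qed
    ultimately show ?case by (auto simp: data_norm_def sup_norm_le_iff)
  qed
  then show ?thesis by blast
qed

section \<open>Stability and error bound\<close>

lemma distinct_nodes_mono: "distinct_nodes A M x \<Longrightarrow> A \<subseteq> B \<Longrightarrow> distinct_nodes B M x"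
  by (auto simp: distinct_nodes_def)

lemma well_posedness_le:
  assumes "sup_norm S u \<le> ereal C * data_norm \<Omega> L u" "0 \<le> C" "y \<in> S"
    and "\<forall>l\<in>test_functionals \<Omega> L. \<bar>l u\<bar> \<le> r"
  shows "\<bar>u y\<bar> \<le> C * r"
proof -
  have "data_norm \<Omega> L u \<le> ereal r" using assms(4) data_norm_le_iff by blast
  then have "ereal C * data_norm \<Omega> L u \<le> ereal C * ereal r"
    using assms(2) by (intro ereal_mult_left_mono) auto
  then have "sup_norm S u \<le> ereal (C * r)" using assms(1) by simp
  then show ?thesis using assms(3) by (simp add: sup_norm_le_iff)
qed

lemma well_posedness_constant_pos:
  assumes "\<Omega> \<noteq> {}" and "sup_norm S u \<le> ereal C * data_norm \<Omega> L u" and "y \<in> S" "u y \<noteq> 0"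
  shows "0 < C"
proof (rule ccontr)
  assume "\<not> 0 < C"
  then have "ereal C * data_norm \<Omega> L u \<le> 0 * data_norm \<Omega> L u"
    by (intro ereal_mult_right_mono data_norm_nonneg assms) auto
  with assms(2) have "sup_norm S u \<le> ereal 0" by (auto intro: order_trans)
  then show False using assms(3,4) unfolding sup_norm_le_iff by auto
qed

text \<open>The combination \<open>u\<close> of the Lagrange basis with coefficients \<open>a\<close> has nodal values \<open>a\<close>, and the
  stiffness matrix maps \<open>a\<close> to the selected functionals at \<open>u\<close>. So the claim is well-posedness for
  \<open>u\<close> at the nodes, with the data norm replaced by twice the discrete one.\<close>

lemma norming_selection_stable:
  assumes K: "strictly_positive_definite D K" and x: "distinct_nodes D M x"
    and sel: "norming_selection \<Lambda> (trial_space K M x) N \<nu>"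
    and U: "function_subspace U" and sub: "trial_space K M x \<subseteq> U"
    and lin: "\<forall>l\<in>\<Lambda>. linear_functional_on U l"
    and wp: "\<And>u r y. u \<in> U \<Longrightarrow> \<forall>l\<in>\<Lambda>. \<bar>l u\<bar> \<le> r \<Longrightarrow> y \<in> D \<Longrightarrow> \<bar>u y\<bar> \<le> C * r"
  shows "stable_stiffness K C M x N \<nu>"
  unfolding stable_stiffness_def
proof (intro conjI allI impI)
  show "\<exists>s. lagrange_basis K M x s" by (rule lagrange_basis_exists[OF K x])
next
  fix s a assume s: "lagrange_basis K M x s"
  define u where "u = (\<lambda>y. \<Sum>j<M. a j * s j y)"
  have uT: "u \<in> trial_space K M x" and ux: "\<And>k. k < M \<Longrightarrow> u (x k) = a k"
    unfolding u_def using lagrange_combination[OF s] by auto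
  have "\<nu> k u = mat_vec M (stiffness_matrix \<nu> s) a k" if "k < N" for k
  proof -
    have "\<nu> k \<in> \<Lambda>" using sel that by (auto simp: norming_selection_def)
    moreover have "\<And>j. j < M \<Longrightarrow> s j \<in> U" using s sub by (auto simp: lagrange_basis_def)
    ultimately show ?thesis
      using linear_functional_sum[OF U bspec[OF lin], of "\<nu> k" M s a]
      by (simp add: u_def mat_vec_def stiffness_matrix_def mult.commute)
  qed
  then have m: "max_norm N (\<lambda>k. \<nu> k u) = max_norm N (mat_vec M (stiffness_matrix \<nu> s) a)"
    unfolding max_norm_def by (intro arg_cong[where f = Max] image_cong) auto
  have "\<bar>u y\<bar> \<le> C * (2 * max_norm N (\<lambda>k. \<nu> k u))" if "y \<in> D" for y
    using sel uT sub that by (intro wp) (auto simp: norming_selection_def)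
  then have "\<bar>a k\<bar> \<le> 2 * C * max_norm N (\<lambda>k. \<nu> k u)" if "k < M" for k
    using x ux[OF that] that by (fastforce simp: distinct_nodes_def algebra_simps)
  then show "max_norm M a \<le> 2 * C * max_norm N (mat_vec M (stiffness_matrix \<nu> s) a)"
    unfolding m using x by (intro max_norm_le) (auto simp: distinct_nodes_def)
qed

text \<open>The norming inequality is available only on \<open>V\<close>, while \<open>u\<close> may lie outside. Hence the detour
  through \<open>w - v\<close>, which is in \<open>V\<close> and whose discrete residual is controlled by those of
  \<open>u - w\<close> and \<open>u - v\<close>.\<close>

lemma norming_selection_error:
  assumes sel: "norming_selection \<Lambda> V N \<nu>"
    and U: "function_subspace U" and V: "function_subspace V" "V \<subseteq> U"
    and lin: "\<forall>l\<in>\<Lambda>. linear_functional_on U l"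
    and uwv: "u \<in> U" "w \<in> V" "v \<in> V" and C\<^sub>A: "1 \<le> C\<^sub>A"
    and min: "approx_residual_min C\<^sub>A N \<nu> u w v"
    and E: "\<forall>l\<in>\<Lambda>. \<bar>l (u - w)\<bar> \<le> E" and l: "l \<in> \<Lambda>"
  shows "\<bar>l (u - v)\<bar> \<le> (2 * C\<^sub>A + 3) * E"
proof -
  have diff: "l (f - g) = l f - l g" if "l \<in> \<Lambda>" "f \<in> U" "g \<in> U" for l f g
    by (rule linear_functional_diff[OF U bspec[OF lin that(1)] that(2,3)])
  have uwvU: "u \<in> U" "w \<in> U" "v \<in> U" using uwv V by auto
  have \<nu>: "\<nu> k \<in> \<Lambda>" if "k < N" for k using sel that by (auto simp: norming_selection_def)
  have N: "1 \<le> N" using sel by (simp add: norming_selection_def)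
  have mw: "max_norm N (\<lambda>k. \<nu> k (u - w)) \<le> E" using N \<nu> E by (intro max_norm_le) auto
  have "max_norm N (\<lambda>k. \<nu> k (u - v)) \<le> C\<^sub>A * max_norm N (\<lambda>k. \<nu> k (u - w))"
    using min by (simp add: approx_residual_min_def)
  also have "\<dots> \<le> C\<^sub>A * E" using mw C\<^sub>A by (intro mult_left_mono) auto
  finally have mv: "max_norm N (\<lambda>k. \<nu> k (u - v)) \<le> C\<^sub>A * E" .
  have "max_norm N (\<lambda>k. \<nu> k (w - v)) \<le> E + C\<^sub>A * E"
  proof (rule max_norm_le[OF N])
    fix k assume k: "k < N"
    have "\<bar>\<nu> k (u - v)\<bar> \<le> C\<^sub>A * E" using max_norm_ge[OF k] mv by (rule order_trans)
    moreover have "\<nu> k (w - v) = \<nu> k (u - v) - \<nu> k (u - w)"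
      using diff[OF \<nu>[OF k]] uwvU by simp
    ultimately show "\<bar>\<nu> k (w - v)\<bar> \<le> E + C\<^sub>A * E" using bspec[OF E \<nu>[OF k]] by linarith
  qed
  then have "2 * max_norm N (\<lambda>k. \<nu> k (w - v)) \<le> 2 * (E + C\<^sub>A * E)" by simp
  moreover have "\<bar>l (w - v)\<bar> \<le> 2 * max_norm N (\<lambda>k. \<nu> k (w - v))"
    using sel l function_subspace_diff[OF V(1) uwv(2,3)] by (auto simp: norming_selection_def)
  ultimately have "\<bar>l (w - v)\<bar> \<le> 2 * (E + C\<^sub>A * E)" by (rule order_trans[rotated])
  moreover have "\<bar>l (u - v)\<bar> \<le> \<bar>l (u - w)\<bar> + \<bar>l (w - v)\<bar>"
    using diff[OF l] uwvU by simp
  moreover have "\<bar>l (u - w)\<bar> \<le> E" by (rule bspec[OF E l])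
  ultimately have "\<bar>l (u - v)\<bar> \<le> E + 2 * (E + C\<^sub>A * E)"
    by (elim order_trans[OF _ add_mono, rotated 2])
  then show ?thesis by (simp add: algebra_simps)
qed

section \<open>The collocation theorem\<close>

theorem theorem13p4:
  fixes \<Omega> :: "(real ^ 'n) set"
    and L :: "(real ^ 'n \<Rightarrow> real) \<Rightarrow> real ^ 'n \<Rightarrow> real"
    and U :: "(real ^ 'n \<Rightarrow> real) set"
    and ip :: "(real ^ 'n \<Rightarrow> real) \<Rightarrow> (real ^ 'n \<Rightarrow> real) \<Rightarrow> real"
    and K :: "real ^ 'n \<Rightarrow> real ^ 'n \<Rightarrow> real"
    and C :: real
  assumes "domain \<Omega>" and "bounded \<Omega>"
    and "elliptic_operator \<Omega> L"
    and "hilbert_function_space (closure \<Omega>) U ip"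
    and "\<forall>u\<in>U. C2_on \<Omega> u \<and> continuous_on (closure \<Omega>) u"
    and "reproducing_kernel (closure \<Omega>) U ip K"
    and "strictly_positive_definite (closure \<Omega>) K"
    and "uniformly_bounded_functionals U ip (test_functionals \<Omega> L)"
    and "\<forall>u\<in>U. sup_norm (closure \<Omega>) u \<le> ereal C * data_norm \<Omega> L u"
  shows "(\<forall>M x. distinct_nodes \<Omega> M x \<longrightarrow> (\<exists>N \<nu>. good_selection \<Omega> L U K C M x N \<nu>)) \<and>
    (\<forall>u\<in>U. \<forall>C\<^sub>A\<ge>1. \<forall>(M :: nat \<Rightarrow> nat) (x :: nat \<Rightarrow> nat \<Rightarrow> real ^ 'n) (N :: nat \<Rightarrow> nat)
        (\<nu> :: nat \<Rightarrow> nat \<Rightarrow> (real ^ 'n \<Rightarrow> real) \<Rightarrow> real)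
        (w :: nat \<Rightarrow> real ^ 'n \<Rightarrow> real) (v :: nat \<Rightarrow> real ^ 'n \<Rightarrow> real) (\<epsilon> :: nat \<Rightarrow> real).
       (\<forall>n. distinct_nodes \<Omega> (M n) (x n) \<and>
            good_selection \<Omega> L U K C (M n) (x n) (N n) (\<nu> n) \<and>
            interpolant K (M n) (x n) u (w n) \<and>
            v n \<in> trial_space K (M n) (x n) \<and>
            approx_residual_min C\<^sub>A (N n) (\<nu> n) u (w n) (v n)) \<and>
       sup_norm_bigo \<Omega> (\<lambda>n. u - w n) \<epsilon> \<and>
       (\<forall>i. sup_norm_bigo \<Omega> (\<lambda>n. partial_deriv i (u - w n)) \<epsilon>) \<and>
       (\<forall>i j. sup_norm_bigo \<Omega> (\<lambda>n. partial_deriv i (partial_deriv j (u - w n))) \<epsilon>) \<longrightarrow>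
       sup_norm_bigo (closure \<Omega>) (\<lambda>n. u - v n) \<epsilon>)"
proof -
  let ?D = "closure \<Omega>" and ?\<Lambda> = "test_functionals \<Omega> L"
  have op: "open \<Omega>" and ne: "\<Omega> \<noteq> {}" using assms(1) by (auto simp: domain_def)
  have U: "function_subspace U"
    using assms(4) unfolding hilbert_function_space_def function_subspace_def by blast
  have C2: "\<And>u. u \<in> U \<Longrightarrow> C2_on \<Omega> u" and cont: "\<And>u. u \<in> U \<Longrightarrow> continuous_on ?D u"
    using assms(5) by auto
  note K = assms(7)
  have \<Lambda>: "?\<Lambda> \<noteq> {}" using ne by (auto simp: test_functionals_def)
  have lin: "\<forall>l\<in>?\<Lambda>. linear_functional_on U l"
    using elliptic_operator_linear[OF assms(3) op U C2]
    by (auto simp: test_functionals_def linear_functional_on_def)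
  obtain B where B: "\<And>l u. l \<in> ?\<Lambda> \<Longrightarrow> u \<in> U \<Longrightarrow> \<bar>l u\<bar> \<le> B * sqrt (ip u u)"
    using assms(8) unfolding uniformly_bounded_functionals_def by blast
  have B: "\<forall>l\<in>?\<Lambda>. \<bar>l u\<bar> \<le> B * sqrt (ip u u)" if "u \<in> U" for u
    using B that by blast
  have wp: "sup_norm ?D u \<le> ereal C * data_norm \<Omega> L u" if "u \<in> U" for u
    using assms(9) that by blast
  have nodes: "distinct_nodes ?D M x" if "distinct_nodes \<Omega> M x" for M x
    using that closure_subset by (rule distinct_nodes_mono)
  have trial: "trial_space K M x \<subseteq> U" if "distinct_nodes \<Omega> M x" for M x
    by (rule trial_space_subset[OF U assms(6) nodes[OF that]])
  \<comment> \<open>Any nonzero function in \<open>U\<close> shows that \<open>C\<close> is positive; one node already provides such a function.\<close>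
  have Cpos: "0 < C" if x: "distinct_nodes \<Omega> M x" for M x
  proof -
    obtain w where w: "w \<in> trial_space K M x" "\<forall>k<M. w (x k) = 1"
      using trial_space_interpolation[OF K nodes[OF x], of "\<lambda>_. 1"] by blast
    have "w \<in> U" using trial[OF x] w by blast
    note wp[OF this]
    moreover have "x 0 \<in> ?D" "w (x 0) \<noteq> 0"
      using nodes[OF x] w by (auto simp: distinct_nodes_def)
    ultimately show ?thesis
      by (rule well_posedness_constant_pos[OF ne])
  qed
  have selection: "\<exists>N \<nu>. good_selection \<Omega> L U K C M x N \<nu>" if x: "distinct_nodes \<Omega> M x" for M x
  proof -
    let ?V = "trial_space K M x"
    note C = Cpos[OF x]
    have wp': "\<bar>u y\<bar> \<le> C * r" if "u \<in> U" "\<forall>l\<in>?\<Lambda>. \<bar>l u\<bar> \<le> r" "y \<in> ?D" for u r y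
      using well_posedness_le[OF wp[OF that(1)] less_imp_le[OF C] that(3,2)] .
    obtain s where s: "lagrange_basis K M x s"
      using lagrange_basis_exists[OF K nodes[OF x]] by blast
    have sU: "s j \<in> U" if "j < M" for j
      using s trial[OF x] that by (auto simp: lagrange_basis_def)
    have range: "range (\<lambda>a y. \<Sum>j<M. a j * s j y) = ?V"
    proof
      show "range (\<lambda>a y. \<Sum>j<M. a j * s j y) \<subseteq> ?V"
        using lagrange_combination[OF s] by auto
      show "?V \<subseteq> range (\<lambda>a y. \<Sum>j<M. a j * s j y)"
        by (intro subsetI range_eqI, rule lagrange_representation[OF K nodes[OF x] s])
    qed
    have bd: "\<bar>l (s j)\<bar> \<le> (\<Sum>j<M. \<bar>B * sqrt (ip (s j) (s j))\<bar>)" if "l \<in> ?\<Lambda>" "j < M" for l j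
      using bspec[OF B[OF sU[OF that(2)]] that(1)]
        member_le_sum[of j "{..<M}" "\<lambda>j. \<bar>B * sqrt (ip (s j) (s j))\<bar>"] that by auto
    have coeff: "\<bar>a j\<bar> \<le> C * r"
      if "\<forall>l\<in>?\<Lambda>. \<bar>l (\<lambda>y. \<Sum>j<M. a j * s j y)\<bar> \<le> r" "j < M" for a r j
    proof -
      have "x j \<in> ?D" using nodes[OF x] that by (auto simp: distinct_nodes_def)
      moreover have "(\<lambda>y. \<Sum>i<M. a i * s i y) \<in> U"
        using sU by (rule function_subspace_sum[OF U])
      ultimately have "\<bar>\<Sum>i<M. a i * s i (x j)\<bar> \<le> C * r"
        using wp' that(1) by blast
      then show ?thesis using lagrange_combination(2)[OF s that(2)] by simp
    qed
    have "\<exists>N \<nu>. norming_selection ?\<Lambda> (range (\<lambda>a y. \<Sum>j<M. a j * s j y)) N \<nu>"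
    proof (rule norming_selection_exists[OF \<Lambda> C])
      show "l (\<lambda>y. \<Sum>j<M. a j * s j y) = (\<Sum>j<M. a j * l (s j))" if "l \<in> ?\<Lambda>" for l a
        by (rule linear_functional_sum[OF U bspec[OF lin that] sU])
      show "\<bar>l (s j)\<bar> \<le> (\<Sum>j<M. \<bar>B * sqrt (ip (s j) (s j))\<bar>)" if "l \<in> ?\<Lambda>" "j < M" for l j
        by (rule bd[OF that])
      show "\<bar>a j\<bar> \<le> C * r"
        if "\<forall>l\<in>?\<Lambda>. \<bar>l (\<lambda>y. \<Sum>j<M. a j * s j y)\<bar> \<le> r" "j < M" for a r j
        by (rule coeff[OF that])
    qed
    then obtain N \<nu> where sel: "norming_selection ?\<Lambda> ?V N \<nu>"
      unfolding range by blast
    have "residual_error_bound \<Omega> L U K C M x N \<nu>"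
      unfolding residual_error_bound_def
    proof (intro allI ballI impI)
      fix C\<^sub>A u w v
      assume h: "1 \<le> C\<^sub>A" "u \<in> U" "w \<in> ?V" "v \<in> ?V" "approx_residual_min C\<^sub>A N \<nu> u w v"
      have uw: "u - w \<in> U" and uv: "u - v \<in> U"
        using h trial[OF x] by (auto intro: function_subspace_diff[OF U])
      obtain E where E: "data_norm \<Omega> L (u - w) = ereal E" "0 \<le> E"
        using data_norm_finite[OF ne B[OF uw]] by blast
      then have "\<forall>l\<in>?\<Lambda>. \<bar>l (u - w)\<bar> \<le> E"
        using data_norm_le_iff[of \<Omega> L "u - w" E] by auto
      then have "\<forall>l\<in>?\<Lambda>. \<bar>l (u - v)\<bar> \<le> (2 * C\<^sub>A + 3) * E"
        using norming_selection_error[OF sel U function_subspace_trial_space trial[OF x] lin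
          h(2-4) h(1) h(5)] by blast
      then have "sup_norm ?D (u - v) \<le> ereal (C * ((2 * C\<^sub>A + 3) * E))"
        unfolding sup_norm_le_iff by (intro ballI) (rule wp'[OF uv])
      then show "sup_norm ?D (u - v) \<le> ereal (C * (2 * C\<^sub>A + 3)) * data_norm \<Omega> L (u - w)"
        by (simp add: E mult.assoc)
    qed
    moreover have "stable_stiffness K C M x N \<nu>"
      by (rule norming_selection_stable[OF K nodes[OF x] sel U trial[OF x] lin]) (rule wp')
    ultimately show ?thesis
      using sel unfolding good_selection_def norming_selection_def by blast
  qed
  show ?thesis
  proof (intro conjI allI ballI impI selection, assumption)
    fix u C\<^sub>A M x N \<nu> w v \<epsilon>
    assume u: "u \<in> U" and C\<^sub>A: "1 \<le> (C\<^sub>A :: real)"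
      and h: "(\<forall>n. distinct_nodes \<Omega> (M n) (x n) \<and>
            good_selection \<Omega> L U K C (M n) (x n) (N n) (\<nu> n) \<and>
            interpolant K (M n) (x n) u (w n) \<and>
            v n \<in> trial_space K (M n) (x n) \<and>
            approx_residual_min C\<^sub>A (N n) (\<nu> n) u (w n) (v n)) \<and>
       sup_norm_bigo \<Omega> (\<lambda>n. u - w n) \<epsilon> \<and>
       (\<forall>i. sup_norm_bigo \<Omega> (\<lambda>n. partial_deriv i (u - w n)) \<epsilon>) \<and>
       (\<forall>i j. sup_norm_bigo \<Omega> (\<lambda>n. partial_deriv i (partial_deriv j (u - w n))) \<epsilon>)"
    have wT: "w n \<in> trial_space K (M n) (x n)" for n using h by (simp add: interpolant_def)
    have uw: "u - w n \<in> U" for n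
      using wT trial h by (intro function_subspace_diff[OF U u]) blast
    define Q where "Q = C * (2 * C\<^sub>A + 3)"
    have "0 < C" using h Cpos by blast
    then have Q: "0 \<le> Q" using C\<^sub>A by (simp add: Q_def)
    obtain c where c: "\<forall>\<^sub>F n in sequentially. data_norm \<Omega> L (u - w n) \<le> ereal (c * \<bar>\<epsilon> n\<bar>)"
      using data_norm_bigo[where e = "\<lambda>n. u - w n" and \<epsilon> = \<epsilon>, OF assms(3) C2[OF uw] cont[OF uw]] h by blast
    have err: "sup_norm ?D (u - v n) \<le> ereal Q * data_norm \<Omega> L (u - w n)" for n
    proof -
      have "residual_error_bound \<Omega> L U K C (M n) (x n) (N n) (\<nu> n)"
        using h by (simp add: good_selection_def)
      then show ?thesis
        using C\<^sub>A u wT[of n] h unfolding residual_error_bound_def Q_def by blast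
    qed
    have "\<forall>\<^sub>F n in sequentially. sup_norm ?D (u - v n) \<le> ereal (Q * c * \<bar>\<epsilon> n\<bar>)"
      using c
    proof eventually_elim
      case (elim n)
      have "ereal Q * data_norm \<Omega> L (u - w n) \<le> ereal Q * ereal (c * \<bar>\<epsilon> n\<bar>)"
        using elim Q by (intro ereal_mult_left_mono) auto
      then show ?case using err[of n] by (simp add: mult.assoc)
    qed
    then show "sup_norm_bigo ?D (\<lambda>n. u - v n) \<epsilon>"
      unfolding sup_norm_bigo_def by blast
  qed
qed

end
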